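(* (i) For every positive integer $d\ge 3$ divisible by $4$, $\lambda_2(H_{d,1})=\frac{3}{4}d$. (ii) For every integer $t\ge 2$ and every integer $d\ge 3$ such that $\frac{d}{t}$ is an integer and $\frac{(t-2)d}{t(t-1)}$ is a non-negative integer, $\lambda_2(H_{d,t})=0$.
   Context: Multigraphs may have multiple edges but have no loops. The adjacency matrix of a multigraph $G$ with $V(G)=\{v_1,\dots,v_n\}$ has $(i,j)$ entry equal to the number of edges with endpoints $v_i,v_j$; $\lambda_2(G)$ is its second largest eigenvalue, counted with multiplicity. Definition of $H_{d,1}$ (for $4\mid d$): let $B_{d,1}$ be the unique multigraph on three vertices $v_1,v_2,v_3$ in which $v_1,v_2$ have degree $d$ and $v_3$ has degree $\frac d2$; that is, there are $\frac{3d}{4}$ edges between $v_1$ and $v_2$, $\frac d4$ edges between $v_2$ and $v_3$, and $\frac d4$ edges between $v_1$ and $v_3$. $H_{d,1}$ is the $5$-vertex $d$-regular multigraph obtained from two disjoint copies of $B_{d,1}$ by identifying their vertices of degree $\frac d2$. Definition of $H_{d,t}$ for $t\ge 2$: let $C_{d,t}$ be the multigraph on $t$ vertices in which every pair of distinct vertices is joined by exactly $\frac{(t-2)d}{t(t-1)}$ edges (no edges if $t=2$). $H_{d,t}$ is obtained from $C_{d,t}$ by adding two new vertices $x,y$ (not adjacent to each other), and adding $\frac dt$ edges between $x$ and each vertex of $C_{d,t}$ and $\frac dt$ edges between $y$ and each vertex of $C_{d,t}$. *)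

theory Defs
  imports "Jordan_Normal_Form.Char_Poly" "HOL-Library.Multiset"
begin

section \<open>Multigraphs\<close>

text \<open>An edge is the set of its two endpoints; parallel edges are repeated elements of the multiset.\<close>

record 'a multigraph =
  verts :: "'a set"
  edges :: "'a set multiset"

definition multigraph :: "'a multigraph \<Rightarrow> bool" where
  "multigraph G \<longleftrightarrow>
     finite (verts G) \<and> (\<forall>e. e \<in># edges G \<longrightarrow> e \<subseteq> verts G \<and> card e = 2)"

definition vdegree :: "'a multigraph \<Rightarrow> 'a \<Rightarrow> nat" where
  "vdegree G v = size (filter_mset (\<lambda>e. v \<in> e) (edges G))"

definition regular :: "nat \<Rightarrow> 'a multigraph \<Rightarrow> bool" where
  "regular d G \<longleftrightarrow> (\<forall>v\<in>verts G. vdegree G v = d)"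

definition map_graph :: "('a \<Rightarrow> 'b) \<Rightarrow> 'a multigraph \<Rightarrow> 'b multigraph" where
  "map_graph f G = \<lparr>verts = f ` verts G, edges = image_mset (image f) (edges G)\<rparr>"

definition disjoint_union :: "'a multigraph \<Rightarrow> 'b multigraph \<Rightarrow> ('a + 'b) multigraph" where
  "disjoint_union G H =
     \<lparr>verts = Inl ` verts G \<union> Inr ` verts H,
      edges = image_mset (image Inl) (edges G) + image_mset (image Inr) (edges H)\<rparr>"

definition identify :: "'a \<Rightarrow> 'a \<Rightarrow> 'a multigraph \<Rightarrow> 'a multigraph" where
  "identify u v G = map_graph (\<lambda>w. if w = v then u else w) G"


section \<open>Adjacency matrix and second largest eigenvalue\<close>

definition adj_mat :: "'a multigraph \<Rightarrow> 'a list \<Rightarrow> real mat" where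
  "adj_mat G vs =
     mat (length vs) (length vs) (\<lambda>(i, j). real (count (edges G) {vs ! i, vs ! j}))"

text \<open>Real eigenvalues, counted with algebraic multiplicity, in decreasing order. For a symmetric
  matrix (such as an adjacency matrix) all eigenvalues are real and the algebraic and
  geometric multiplicities agree.\<close>

definition eigenvalues_desc :: "real mat \<Rightarrow> real list" where
  "eigenvalues_desc A = rev (sorted_list_of_multiset (proots (char_poly A)))"

definition enumeration :: "'a multigraph \<Rightarrow> 'a list \<Rightarrow> bool" where
  "enumeration G vs \<longleftrightarrow> distinct vs \<and> set vs = verts G"

text \<open>The choice of the enumeration is irrelevant, see \<open>lambda2_eq\<close> below. Index 1 is the second
  entry of the list.\<close>

definition lambda2 :: "'a multigraph \<Rightarrow> real" where
  "lambda2 G = eigenvalues_desc (adj_mat G (SOME vs. enumeration G vs)) ! 1"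

lemma similar_adj_mat:
  assumes "enumeration G vs" "enumeration G ws"
  shows "similar_mat (adj_mat G vs) (adj_mat G ws)"
proof -
  define n where "n = length vs"
  have dist: "distinct vs" "distinct ws" and set_eq: "set vs = set ws"
    using assms by (auto simp: enumeration_def)
  have len: "length ws = n"
    using dist set_eq by (metis n_def distinct_card)
  define P :: "real mat" where "P = mat n n (\<lambda>(i, k). of_bool (vs ! i = ws ! k))"
  define Q :: "real mat" where "Q = mat n n (\<lambda>(k, i). of_bool (vs ! i = ws ! k))"
  have sum1: "(\<Sum>k = 0..<n. of_bool (v = ws ! k) * f (ws ! k)) = f v"
    if "v \<in> set ws" for v and f :: "'a \<Rightarrow> real"
  proof -
    have "(\<Sum>k = 0..<n. of_bool (v = ws ! k) * f (ws ! k)) = (\<Sum>k = 0..<n. if v = ws ! k then f (ws ! k) else 0)"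
      by (rule sum.cong) auto
    also have "\<dots> = (\<Sum>w\<in>set ws. if v = w then f w else 0)"
      by (rule sum.reindex_bij_betw[OF bij_betw_nth]) (use dist len in auto)
    also have "\<dots> = f v" using that by simp
    finally show ?thesis .
  qed
  have sum2: "(\<Sum>k = 0..<n. of_bool (vs ! k = w) * f (vs ! k)) = f w"
    if "w \<in> set vs" for w and f :: "'a \<Rightarrow> real"
  proof -
    have "(\<Sum>k = 0..<n. of_bool (vs ! k = w) * f (vs ! k)) = (\<Sum>k = 0..<n. if vs ! k = w then f (vs ! k) else 0)"
      by (rule sum.cong) auto
    also have "\<dots> = (\<Sum>v\<in>set vs. if v = w then f v else 0)"
      by (rule sum.reindex_bij_betw[OF bij_betw_nth]) (use dist n_def in auto)
    also have "\<dots> = f w" using that by simp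
    finally show ?thesis .
  qed
  have vs_in: "vs ! i \<in> set ws" if "i < n" for i
    using that unfolding n_def set_eq[symmetric] by (rule nth_mem)
  have ws_in: "ws ! i \<in> set vs" if "i < n" for i
    using that unfolding len[symmetric] set_eq by (rule nth_mem)
  have carr: "P \<in> carrier_mat n n" "Q \<in> carrier_mat n n"
    "adj_mat G vs \<in> carrier_mat n n" "adj_mat G ws \<in> carrier_mat n n"
    by (simp_all add: P_def Q_def adj_mat_def len flip: n_def)
  have PQ: "P * Q = 1\<^sub>m n"
  proof (rule eq_matI)
    fix i j assume "i < dim_row (1\<^sub>m n :: real mat)" "j < dim_col (1\<^sub>m n :: real mat)"
    then have ij: "i < n" "j < n" by auto
    have "(P * Q) $$ (i, j) = (\<Sum>k = 0..<n. of_bool (vs ! i = ws ! k) * of_bool (vs ! j = ws ! k))"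
      using ij by (simp add: P_def Q_def scalar_prod_def)
    also have "\<dots> = of_bool (vs ! j = vs ! i)"
      using sum1[of "vs ! i" "\<lambda>w. of_bool (vs ! j = w)"] vs_in ij by simp
    also have "\<dots> = 1\<^sub>m n $$ (i, j)"
      using ij dist by (auto simp: nth_eq_iff_index_eq n_def)
    finally show "(P * Q) $$ (i, j) = 1\<^sub>m n $$ (i, j)" .
  qed (use carr in auto)
  have QP: "Q * P = 1\<^sub>m n" using PQ carr by (meson mat_mult_left_right_inverse)
  have "P * adj_mat G ws = mat n n (\<lambda>(i, k). real (count (edges G) {vs ! i, ws ! k}))" (is "_ = ?M")
  proof (rule eq_matI)
    fix i j assume "i < dim_row ?M" "j < dim_col ?M"
    then have ij: "i < n" "j < n" by auto
    have "(P * adj_mat G ws) $$ (i, j) =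
        (\<Sum>k = 0..<n. of_bool (vs ! i = ws ! k) * real (count (edges G) {ws ! k, ws ! j}))"
      using ij len by (simp add: P_def adj_mat_def scalar_prod_def)
    also have "\<dots> = real (count (edges G) {vs ! i, ws ! j})"
      using sum1[of "vs ! i" "\<lambda>w. real (count (edges G) {w, ws ! j})"] vs_in ij by simp
    finally show "(P * adj_mat G ws) $$ (i, j) = ?M $$ (i, j)" using ij by simp
  qed (use carr in auto)
  moreover have "adj_mat G vs * P = ?M"
  proof (rule eq_matI)
    fix i j assume "i < dim_row ?M" "j < dim_col ?M"
    then have ij: "i < n" "j < n" by auto
    have "(adj_mat G vs * P) $$ (i, j) =
        (\<Sum>k = 0..<n. of_bool (vs ! k = ws ! j) * real (count (edges G) {vs ! i, vs ! k}))"
      using ij n_def by (simp add: P_def adj_mat_def scalar_prod_def mult.commute)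
    also have "\<dots> = real (count (edges G) {vs ! i, ws ! j})"
      using sum2[of "ws ! j" "\<lambda>w. real (count (edges G) {vs ! i, w})"] ws_in ij by simp
    finally show "(adj_mat G vs * P) $$ (i, j) = ?M $$ (i, j)" using ij by simp
  qed (use carr in auto)
  ultimately have "P * adj_mat G ws * Q = adj_mat G vs * (P * Q)"
    using assoc_mult_mat[OF carr(3) carr(1) carr(2)] by simp
  then have "adj_mat G vs = P * adj_mat G ws * Q" using PQ carr by simp
  with PQ QP carr show ?thesis by (intro similar_matI[of _ _ P Q n]) auto
qed

lemma lambda2_eq:
  assumes "enumeration G vs"
  shows "lambda2 G = eigenvalues_desc (adj_mat G vs) ! 1"
  using char_poly_similar[OF similar_adj_mat[OF someI[of "enumeration G", OF assms] assms]]
  by (simp add: lambda2_def eigenvalues_desc_def)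


section \<open>The graph $H_{d,1}$\<close>

definition B1_graph :: "nat \<Rightarrow> nat multigraph" where
  "B1_graph d = \<lparr>verts = {1, 2, 3},
     edges = replicate_mset (3 * d div 4) {1, 2} + replicate_mset (d div 4) {2, 3}
           + replicate_mset (d div 4) {1, 3}\<rparr>"

definition H1_graph :: "nat \<Rightarrow> (nat + nat) multigraph" where
  "H1_graph d = identify (Inl 3) (Inr 3) (disjoint_union (B1_graph d) (B1_graph d))"

lemma size_filter_replicate_mset:
  "size (filter_mset P (replicate_mset n x)) = (if P x then n else 0)"
  by (induction n) auto

lemma B1_graph_degrees:
  assumes "4 dvd d"
  shows "multigraph (B1_graph d)" "vdegree (B1_graph d) 1 = d" "vdegree (B1_graph d) 2 = d"
    "vdegree (B1_graph d) 3 = d div 2"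
  using assms
  by (auto simp: multigraph_def B1_graph_def vdegree_def size_filter_replicate_mset split: if_splits)

lemma H1_graph_eq:
  "H1_graph d = \<lparr>verts = {Inl 1, Inl 2, Inl 3, Inr 1, Inr 2},
     edges = replicate_mset (3 * d div 4) {Inl 1, Inl 2} + replicate_mset (d div 4) {Inl 2, Inl 3}
           + replicate_mset (d div 4) {Inl 1, Inl 3}
           + (replicate_mset (3 * d div 4) {Inr 1, Inr 2} + replicate_mset (d div 4) {Inr 2, Inl 3}
           + replicate_mset (d div 4) {Inr 1, Inl 3})\<rparr>"
  unfolding H1_graph_def identify_def map_graph_def disjoint_union_def B1_graph_def by auto

lemma H1_graph_regular:
  assumes "4 dvd d"
  shows "multigraph (H1_graph d)" "card (verts (H1_graph d)) = 5" "regular d (H1_graph d)"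
proof -
  show "multigraph (H1_graph d)"
    by (auto simp: multigraph_def H1_graph_eq dest!: in_replicate_mset[THEN iffD1])
  show "card (verts (H1_graph d)) = 5" by (simp add: H1_graph_eq)
  obtain k where "d = 4 * k" using assms unfolding dvd_def by blast
  then show "regular d (H1_graph d)"
    by (simp add: regular_def vdegree_def H1_graph_eq size_filter_replicate_mset)
qed


section \<open>The graphs $H_{d,t}$ for $t \geq 2$\<close>

definition C_graph :: "nat \<Rightarrow> nat \<Rightarrow> nat multigraph" where
  "C_graph d t = \<lparr>verts = {1..t},
     edges = (\<Sum>e\<in>{e. e \<subseteq> {1..t} \<and> card e = 2}.
                replicate_mset ((t - 2) * d div (t * (t - 1))) e)\<rparr>"

datatype 'a with_xy = Old 'a | New_x | New_y

definition H_graph :: "nat \<Rightarrow> nat \<Rightarrow> nat with_xy multigraph" where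
  "H_graph d t = \<lparr>verts = Old ` verts (C_graph d t) \<union> {New_x, New_y},
     edges = image_mset (image Old) (edges (C_graph d t))
           + (\<Sum>v\<in>verts (C_graph d t). replicate_mset (d div t) {New_x, Old v})
           + (\<Sum>v\<in>verts (C_graph d t). replicate_mset (d div t) {New_y, Old v})\<rparr>"

lemma size_filter_sum_replicate_mset:
  assumes "finite A"
  shows "size (filter_mset P (\<Sum>x\<in>A. replicate_mset n (g x))) = n * card {x \<in> A. P (g x)}"
proof -
  have "size (filter_mset P (\<Sum>x\<in>A. replicate_mset n (g x))) = (\<Sum>x\<in>A. if P (g x) then n else 0)"
    using assms by (induction rule: finite_induct) (auto simp: size_filter_replicate_mset)
  also have "\<dots> = n * card {x \<in> A. P (g x)}"
    using assms by (simp add: sum.If_cases Int_def mult.commute)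
  finally show ?thesis .
qed

lemma C_graph_degree:
  assumes "i \<in> {1..t}"
  shows "vdegree (C_graph d t) i = ((t - 2) * d div (t * (t - 1))) * (t - 1)"
proof -
  have "{e \<in> {e. e \<subseteq> {1..t} \<and> card e = 2}. i \<in> e} = (\<lambda>j. {i, j}) ` ({1..t} - {i})"
    using assms by (fastforce simp: card_2_iff)
  moreover have "inj_on (\<lambda>j. {i, j}) ({1..t} - {i})"
    by (auto simp: inj_on_def doubleton_eq_iff)
  ultimately have "card {e \<in> {e. e \<subseteq> {1..t} \<and> card e = 2}. i \<in> e} = t - 1"
    using assms by (simp add: card_image)
  moreover have "finite {e. e \<subseteq> {1..t} \<and> card e = 2}" by simp
  ultimately show ?thesis
    unfolding vdegree_def C_graph_def
    using size_filter_sum_replicate_mset[of "{e. e \<subseteq> {1..t} \<and> card e = 2}" "\<lambda>e. i \<in> e" _ "\<lambda>e. e"]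
    by simp
qed

lemma C_graph_multigraph: "multigraph (C_graph d t)"
  by (auto simp: multigraph_def C_graph_def set_mset_sum split: if_splits)

lemma H_graph_regular:
  assumes "t \<ge> 2" "t dvd d" "t * (t - 1) dvd (t - 2) * d"
  shows "multigraph (H_graph d t)" "card (verts (H_graph d t)) = t + 2" "regular d (H_graph d t)"
proof -
  show "multigraph (H_graph d t)"
    using C_graph_multigraph[of d t]
    by (auto simp: multigraph_def H_graph_def set_mset_sum card_image inj_on_def split: if_splits)
  have "card (Old ` {1..t}) = t" by (simp add: card_image inj_on_def)
  then show "card (verts (H_graph d t)) = t + 2"
    by (subst H_graph_def, subst multigraph.simps, subst card_Un_disjoint) (auto simp: C_graph_def)
  have "vdegree (H_graph d t) (Old i) = d" if i: "i \<in> {1..t}" for i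
  proof -
    obtain m where m: "(t - 2) * d = t * (t - 1) * m" using assms(3) unfolding dvd_def by blast
    obtain k where k: "d = t * k" using assms(2) unfolding dvd_def by blast
    have tm: "(t - 1) * m = (t - 2) * k"
    proof -
      have "t * ((t - 1) * m) = t * ((t - 2) * k)" 
        using arg_cong[OF k, of "\<lambda>x. (t - 2) * x"] m by (metis mult.assoc mult.left_commute)
      then show ?thesis using assms(1) by simp
    qed
    have q: "(t - 2) * d div (t * (t - 1)) = m"
      using m assms(1) by simp
    have "size {#e \<in># image_mset (image Old) (edges (C_graph d t)). Old i \<in> e#}
        = vdegree (C_graph d t) i"
      by (simp add: vdegree_def filter_mset_image_mset image_iff)
    moreover have "{v \<in> {1..t}. Old i \<in> {New_x, Old v}} = {i}"
        "{v \<in> {1..t}. Old i \<in> {New_y, Old v}} = {i}"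
      using i by auto
    moreover have "edges (H_graph d t) = image_mset (image Old) (edges (C_graph d t))
        + (\<Sum>v\<in>{1..t}. replicate_mset k {New_x, Old v})
        + (\<Sum>v\<in>{1..t}. replicate_mset k {New_y, Old v})"
      using k assms(1) by (simp add: H_graph_def C_graph_def)
    ultimately have "vdegree (H_graph d t) (Old i) = vdegree (C_graph d t) i + 2 * k"
      by (simp only: vdegree_def[of "H_graph d t"] filter_union_mset size_union
          size_filter_sum_replicate_mset finite_atLeastAtMost) simp
    also have "vdegree (C_graph d t) i = m * (t - 1)"
      using C_graph_degree[OF i, of d] q by simp
    also have "m * (t - 1) + 2 * k = (t - 2) * k + 2 * k" using tm by (simp add: mult.commute)
    also have "\<dots> = d" using k le_Suc_ex[OF assms(1)] by (auto simp: algebra_simps)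
    finally show ?thesis .
  qed
  moreover have "vdegree (H_graph d t) v = d" if "v \<in> {New_x, New_y}" for v
  proof -
    have old: "{#e \<in># image_mset (image Old) (edges (C_graph d t)). v \<in> e#} = {#}"
      using that by auto
    have "{u. Suc 0 \<le> u \<and> u \<le> t} = {1..t}" by auto
    then have new: "card {u \<in> {1..t}. v \<in> {New_x, Old u}} + card {u \<in> {1..t}. v \<in> {New_y, Old u}} = t"
      using that by auto
    have "vdegree (H_graph d t) v = d div t * card {u \<in> {1..t}. v \<in> {New_x, Old u}}
        + d div t * card {u \<in> {1..t}. v \<in> {New_y, Old u}}"
      by (simp only: vdegree_def H_graph_def multigraph.simps filter_union_mset size_union old)
        (simp add: size_filter_sum_replicate_mset C_graph_def)
    then show ?thesis
      using new assms(2) by (simp flip: distrib_left)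
  qed
  ultimately show "regular d (H_graph d t)"
    by (auto simp: regular_def H_graph_def C_graph_def)
qed

end

theory Submission
  imports Defs
begin

text \<open>Each adjacency matrix is conjugated into an upper triangular one by a unitriangular change of
  basis; the new basis starts with vectors constant on the classes of an equitable partition
  and is completed by unit vectors. The spectra read off the diagonals are
  \<open>d, 3d/4, -d/4, -3d/4, -3d/4\<close> and \<open>d, 0, -2d/t\<close> together with \<open>t - 1\<close> copies of
  \<open>-(t - 2)d/(t(t - 1))\<close>.\<close>

section \<open>The second largest eigenvalue from a triangular form\<close>

lemma nth_1_rev_sorted_list_of_multiset:
  fixes a b :: "'a::linorder"
  assumes "b \<le> a" "\<And>x. x \<in># M \<Longrightarrow> x \<le> b"
  shows "rev (sorted_list_of_multiset (add_mset a (add_mset b M))) ! 1 = b"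
proof -
  define xs where "xs = sorted_list_of_multiset M @ [b, a]"
  have "sorted xs"
    using assms by (fastforce simp: xs_def sorted_append)
  then have "sorted_list_of_multiset (mset xs) = xs"
    by (simp add: sorted_list_of_multiset_mset sorted_sort_id)
  moreover have "mset xs = add_mset a (add_mset b M)"
    by (simp add: xs_def)
  ultimately have "sorted_list_of_multiset (add_mset a (add_mset b M)) = xs"
    by simp
  then show ?thesis by (simp add: xs_def)
qed

lemma proots_prod_list_linear:
  fixes xs :: "'a::idom list"
  shows "proots (\<Prod>a\<leftarrow>xs. [:- a, 1:]) = mset xs"
proof (induction xs)
  case (Cons a xs)
  \<comment> \<open>\<open>proots_mult\<close> adds up the root multisets of two factors only if
    their product is nonzero.\<close>
  have "(\<Prod>a\<leftarrow>xs. [:- a, 1:]) \<noteq> 0"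
    by (auto simp: prod_list_zero_iff)
  with Cons show ?case by (simp add: proots_mult del: mult_pCons_left)
qed simp

text \<open>The determinant of the triangular \<open>P\<close> is the product of its nonzero
  diagonal entries, so \<open>P\<close> is invertible and \<open>A\<close> is similar to
  \<open>D\<close>. No inverse has to be exhibited; the identity \<open>A * P = P * D\<close> is
  enough.\<close>

lemma char_poly_triangularized:
  fixes A P D :: "'a::field mat"
  assumes carr: "A \<in> carrier_mat n n" "P \<in> carrier_mat n n" "D \<in> carrier_mat n n"
    and AP: "A * P = P * D"
    and P_lower: "\<And>i j. i < j \<Longrightarrow> j < n \<Longrightarrow> P $$ (i, j) = 0"
    and P_diag: "\<And>i. i < n \<Longrightarrow> P $$ (i, i) \<noteq> 0"
    and D_upper: "upper_triangular D"
  shows "char_poly A = (\<Prod>a\<leftarrow>diag_mat D. [:- a, 1:])"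
proof -
  have "det P = prod_list (diag_mat P)"
    using P_lower carr(2) by (rule det_lower_triangular)
  also have "\<dots> \<noteq> 0"
    using P_diag carr(2) by (auto simp: prod_list_zero_iff diag_mat_def)
  finally obtain Q where Q: "Q \<in> carrier_mat n n" "P * Q = 1\<^sub>m n" "Q * P = 1\<^sub>m n"
    using det_non_zero_imp_unit[OF carr(2), of "()"] by (auto simp: Units_def ring_mat_def)
  have "P * D * Q = A * (P * Q)"
    using AP assoc_mult_mat[OF carr(1,2) Q(1)] by simp
  then have "A = P * D * Q" using Q carr by simp
  with Q carr have "similar_mat A D" by (intro similar_matI[of _ _ P Q n]) auto
  then show ?thesis
    using char_poly_similar char_poly_upper_triangular[OF carr(3) D_upper] by metis
qed

text \<open>Common frame for both families: two entries \<open>a\<close> and \<open>b\<close> are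
  split off the diagonal of \<open>D\<close>, and the others need only be bounded by
  \<open>b\<close>, not sorted.\<close>

lemma lambda2_triangularized:
  assumes "enumeration G vs" "length vs = n"
    and "P \<in> carrier_mat n n" "D \<in> carrier_mat n n"
    and "adj_mat G vs * P = P * D"
    and "\<And>i j. i < j \<Longrightarrow> j < n \<Longrightarrow> P $$ (i, j) = 0"
    and "\<And>i. i < n \<Longrightarrow> P $$ (i, i) \<noteq> 0"
    and "upper_triangular D"
    and "mset (diag_mat D) = add_mset a (add_mset b M)"
    and "b \<le> a" "\<And>x. x \<in># M \<Longrightarrow> x \<le> b"
  shows "lambda2 G = b"
proof -
  have "adj_mat G vs \<in> carrier_mat n n"
    using assms(2) by (simp add: adj_mat_def)
  from char_poly_triangularized[OF this assms(3-8)]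
  have "eigenvalues_desc (adj_mat G vs) = rev (sorted_list_of_multiset (add_mset a (add_mset b M)))"
    by (simp add: eigenvalues_desc_def proots_prod_list_linear assms(9))
  then show ?thesis
    using lambda2_eq[OF assms(1)] nth_1_rev_sorted_list_of_multiset[OF assms(10,11)] by simp
qed

section \<open>The spectrum of \<open>H1_graph\<close>\<close>

lemma lambda2_H1_graph:
  assumes "4 dvd d"
  shows "lambda2 (H1_graph d) = 3 / 4 * real d"
proof -
  obtain k where d: "d = 4 * k" using assms unfolding dvd_def by blast
  define r where "r = real k"
  define vs :: "(nat + nat) list" where "vs = [Inl 1, Inl 3, Inr 1, Inl 2, Inr 2]"
  \<comment> \<open>In this order of the vertices, the columns of \<open>P\<close> are the all-ones vector, the indicator of
    the shared vertex, the indicator of the second copy, and two further unit vectors.\<close>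
  define A where "A = mat_of_rows_list 5
    [[0, r, 0, 3 * r, 0],
     [r, 0, r, r, r],
     [0, r, 0, 0, 3 * r],
     [3 * r, r, 0, 0, 0],
     [0, r, 3 * r, 0, 0]]"
  define P :: "real mat" where "P = mat_of_rows_list 5
    [[1, 0, 0, 0, 0],
     [1, 1, 0, 0, 0],
     [1, 0, 1, 0, 0],
     [1, 0, 0, 1, 0],
     [1, 0, 1, 0, 1]]"
  \<comment> \<open>Column \<open>j\<close> holds the coordinates of \<open>A\<close> times column
    \<open>j\<close> of \<open>P\<close> in the basis of columns of \<open>P\<close>. The leading 3
    by 3 block is the quotient by the partition into first copy, shared vertex and second copy (both
    copies without the shared vertex), in the chosen basis; it contributes \<open>4 * r\<close>,
    \<open>- r\<close> and \<open>3 * r\<close>.\<close>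
  define D where "D = mat_of_rows_list 5
    [[4 * r, r, 0, 3 * r, 0],
     [0, - r, 2 * r, - (2 * r), r],
     [0, 0, 3 * r, - (3 * r), 3 * r],
     [0, 0, 0, - (3 * r), 0],
     [0, 0, 0, 0, - (3 * r)]]"
  have upt5: "[0..<5] = [0, 1, 2, 3, 4::nat]" by (simp add: upt_rec)
  have less5: "i < 5 \<longleftrightarrow> i \<in> {0, 1, 2, 3, 4}" for i :: nat by auto
  have adj: "adj_mat (H1_graph d) vs = A"
  proof (rule eq_matI)
    fix i j assume "i < dim_row A" "j < dim_col A"
    then have "i \<in> {0, 1, 2, 3, 4}" "j \<in> {0, 1, 2, 3, 4}"
      by (auto simp: A_def mat_of_rows_list_def)
    then show "adj_mat (H1_graph d) vs $$ (i, j) = A $$ (i, j)"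
      by (elim insertE emptyE)
        (simp_all add: adj_mat_def vs_def A_def mat_of_rows_list_def H1_graph_eq d r_def
          doubleton_eq_iff)
  qed (simp_all add: adj_mat_def vs_def A_def mat_of_rows_list_def)
  have carr: "A \<in> carrier_mat 5 5" "P \<in> carrier_mat 5 5" "D \<in> carrier_mat 5 5"
    by (auto simp: A_def P_def D_def mat_of_rows_list_def)
  show ?thesis
  proof (rule lambda2_triangularized[where P = P and D = D and n = 5])
    show "enumeration (H1_graph d) vs"
      by (auto simp: enumeration_def vs_def H1_graph_eq)
    show "adj_mat (H1_graph d) vs * P = P * D"
      unfolding adj
    proof (rule eq_matI)
      fix i j assume "i < dim_row (P * D)" "j < dim_col (P * D)"
      then have "i \<in> {0, 1, 2, 3, 4}" "j \<in> {0, 1, 2, 3, 4}" using carr by auto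
      then show "(A * P) $$ (i, j) = (P * D) $$ (i, j)"
        by (elim insertE emptyE)
          (simp_all add: A_def P_def D_def mat_of_rows_list_def scalar_prod_def
            sum.atLeast0_lessThan_Suc numeral_eq_Suc)
    qed (use carr in auto)
    show "P $$ (i, j) = 0" if "i < j" "j < 5" for i j
    proof -
      have "i \<in> {0, 1, 2, 3, 4}" "j \<in> {0, 1, 2, 3, 4}" using that by auto
      with that(1) show ?thesis by (auto simp: P_def mat_of_rows_list_def)
    qed
    show "P $$ (i, i) \<noteq> 0" if "i < 5" for i
      using that unfolding less5 by (auto simp: P_def mat_of_rows_list_def)
    show "upper_triangular D"
    proof
      fix i j assume "j < i" "i < dim_row D"
      then have "i \<in> {0, 1, 2, 3, 4}" "j \<in> {0, 1, 2, 3, 4}" using carr by auto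
      with \<open>j < i\<close> show "D $$ (i, j) = 0" by (auto simp: D_def mat_of_rows_list_def)
    qed
    show "mset (diag_mat D) =
        add_mset (4 * r) (add_mset (3 / 4 * real d) {# - r, - (3 * r), - (3 * r) #})"
      by (simp add: diag_mat_def D_def mat_of_rows_list_def upt5 d r_def)
  qed (use carr in \<open>auto simp: vs_def d r_def\<close>)
qed

section \<open>The spectrum of \<open>H_graph\<close>\<close>

lemma count_image_mset_inj:
  assumes "inj f"
  shows "count (image_mset f M) (f x) = count M x"
  using assms by (induction M) (auto simp: inj_eq)

lemma count_edges_C_graph:
  "count (edges (C_graph d t)) e =
    (if e \<subseteq> {1..t} \<and> card e = 2 then (t - 2) * d div (t * (t - 1)) else 0)"
  unfolding C_graph_def by (simp add: count_sum)

lemma count_edges_H_graph: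
  shows "count (edges (H_graph d t)) {Old i, Old j} = count (edges (C_graph d t)) {i, j}"
    and "u \<in> {New_x, New_y} \<Longrightarrow> i \<in> {1..t} \<Longrightarrow> count (edges (H_graph d t)) {u, Old i} = d div t"
    and "u \<in> {New_x, New_y} \<Longrightarrow> v \<in> {New_x, New_y} \<Longrightarrow> count (edges (H_graph d t)) {u, v} = 0"
proof -
  have "inj (image (Old :: nat \<Rightarrow> nat with_xy))" by (auto intro: injI simp: inj_image_eq_iff)
  from count_image_mset_inj[OF this, of _ "{i, j}"]
  show "count (edges (H_graph d t)) {Old i, Old j} = count (edges (C_graph d t)) {i, j}"
    by (simp add: H_graph_def count_sum doubleton_eq_iff)
  have no_new: "count (image_mset (image Old) M) e = 0"
    if "New_x \<in> e \<or> New_y \<in> e" for M :: "nat set multiset" and e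
    using that by (auto simp: count_eq_zero_iff)
  show "count (edges (H_graph d t)) {u, Old i} = d div t" if "u \<in> {New_x, New_y}" "i \<in> {1..t}"
    using that by (auto simp: H_graph_def no_new count_sum doubleton_eq_iff C_graph_def)
  show "count (edges (H_graph d t)) {u, v} = 0" if "u \<in> {New_x, New_y}" "v \<in> {New_x, New_y}"
    using that by (auto simp: H_graph_def no_new count_sum doubleton_eq_iff)
qed

lemma lambda2_H_graph:
  assumes t: "2 \<le> t" and "t dvd d" "t * (t - 1) dvd (t - 2) * d"
  shows "lambda2 (H_graph d t) = 0"
proof -
  define m c where "m = real (d div t)" and "c = real ((t - 2) * d div (t * (t - 1)))"
  obtain s where s: "t = Suc (Suc s)"
    using le_Suc_ex[OF t] by auto
  \<comment> \<open>Degree count at an old vertex: of its \<open>d = t * m\<close> edges,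
    \<open>2 * m\<close> go to \<open>x\<close> and \<open>y\<close>, which leaves
    \<open>(t - 2) * m\<close> for its \<open>t - 1\<close> old neighbours. Both natural divisions
    are exact by assumption.\<close>
  have c_degree: "(real s + 1) * c = real s * m"
  proof -
    have "t * (t - 1) * ((t - 2) * d div (t * (t - 1))) = (t - 2) * (t * (d div t))"
      using assms by simp
    then have "t * ((t - 1) * ((t - 2) * d div (t * (t - 1)))) = t * ((t - 2) * (d div t))"
      by (simp only: ac_simps)
    then have "(t - 1) * ((t - 2) * d div (t * (t - 1))) = (t - 2) * (d div t)"
      using t by simp
    from arg_cong[OF this, of real] show ?thesis
      by (simp add: s m_def c_def distrib_right)
  qed
  \<comment> \<open>The columns of \<open>P\<close> are the all-ones vector, \<open>x + y\<close>, \<open>y\<close> and unit vectors of old vertices.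
    Listing one old vertex first, then \<open>x\<close> and \<open>y\<close>, makes \<open>P\<close> lower triangular.\<close>
  define v where "v i = (if i = 0 then Old 1 else if i = 1 then New_x else if i = 2 then New_y
    else Old (i - 1))" for i :: nat
  \<comment> \<open>The adjacency entries in terms of indices, where 1 and 2 stand for
    \<open>x\<close> and \<open>y\<close>.\<close>
  define w where "w i j = (if i = j then 0 else if i \<in> {1, 2} \<and> j \<in> {1, 2} then 0
    else if i \<in> {1, 2} \<or> j \<in> {1, 2} then m else c)" for i j :: nat
  define vs where "vs = map v [0..<t + 2]"
  define P :: "real mat" where "P = mat (t + 2) (t + 2)
    (\<lambda>(i, j). of_bool (j = 0 \<or> i = j \<or> i = 2 \<and> j = 1))"
  \<comment> \<open>Again coordinates in the columns of \<open>P\<close>. As \<open>x\<close> and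
    \<open>y\<close> have the same neighbours with the same multiplicity \<open>m\<close>, the image
    of \<open>y\<close> is \<open>m\<close> times the all-ones vector minus \<open>m\<close> times
    \<open>x + y\<close>; this produces the eigenvalue 0 at index 2. An old unit vector goes to
    \<open>c\<close> times all-ones plus \<open>m - c\<close> times \<open>x + y\<close> minus
    \<open>c\<close> times itself.\<close>
  define D where "D = mat (t + 2) (t + 2) (\<lambda>(i, j).
    if i = 0 then (if j = 0 then t * m else if j = 1 then 2 * m else if j = 2 then m else c)
    else if i = 1 then (if j = 0 then 0 else if j = 1 then - (2 * m) else if j = 2 then - m
      else m - c)
    else if i = j \<and> i \<noteq> 2 then - c else 0)"
  have v_new: "v i \<in> {New_x, New_y}" if "i \<in> {1, 2}" for i
    using that by (auto simp: v_def)
  have v_old: "\<exists>a\<in>{1..t}. v i = Old a" if "i \<notin> {1, 2}" "i < t + 2" for i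
    using that t by (auto simp: v_def)
  have v_eq_iff: "v i = v j \<longleftrightarrow> i = j" for i j
    by (auto simp: v_def split: if_splits)
  have edge: "real (count (edges (H_graph d t)) {v i, v j}) = w i j"
    if less: "i < t + 2" "j < t + 2" for i j
  proof (cases "i \<in> {1, 2}"; cases "j \<in> {1, 2}")
    assume "i \<in> {1, 2}" "j \<in> {1, 2}"
    then show ?thesis
      using count_edges_H_graph(3)[OF v_new v_new] by (simp add: w_def)
  next
    assume ij: "i \<in> {1, 2}" "j \<notin> {1, 2}"
    obtain b where "b \<in> {1..t}" "v j = Old b" using v_old[OF ij(2) less(2)] by blast
    with ij show ?thesis
      using count_edges_H_graph(2)[OF v_new] by (auto simp: w_def m_def)
  next
    assume ij: "i \<notin> {1, 2}" "j \<in> {1, 2}"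
    obtain a where "a \<in> {1..t}" "v i = Old a" using v_old[OF ij(1) less(1)] by blast
    with ij show ?thesis
      using count_edges_H_graph(2)[OF v_new] by (auto simp: w_def m_def insert_commute)
  next
    assume ij: "i \<notin> {1, 2}" "j \<notin> {1, 2}"
    obtain a b where "a \<in> {1..t}" "v i = Old a" "b \<in> {1..t}" "v j = Old b"
      using v_old[OF ij(1) less(1)] v_old[OF ij(2) less(2)] by blast
    \<comment> \<open>For \<open>i = j\<close> the set \<open>{a, b}\<close> has a single element,
      so its count is 0; otherwise \<open>v_eq_iff\<close> yields distinct \<open>a\<close> and
      \<open>b\<close>.\<close>
    with ij v_eq_iff[of i j] show ?thesis
      by (auto simp: w_def c_def count_edges_H_graph(1) count_edges_C_graph)
  qed
  have adj: "adj_mat (H_graph d t) vs = mat (t + 2) (t + 2) (\<lambda>(i, j). w i j)"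
    by (rule eq_matI) (auto simp: adj_mat_def vs_def edge simp del: upt_Suc)
  have row_sum: "(\<Sum>k = 0..<t + 2. w i k) = t * m" if less: "i < t + 2" for i
  proof -
    \<comment> \<open>Indices from 3 on are the \<open>s + 1\<close> old vertices other than
      \<open>Old 1\<close>.\<close>
    have split: "(\<Sum>k = 0..<t + 2. w i k) = w i 0 + w i 1 + w i 2 + (\<Sum>k<Suc s. w i (k + 3))"
      by (simp add: s sum.atLeast0_lessThan_Suc_shift lessThan_atLeast0 numeral_eq_Suc
          del: sum.op_ivl_Suc sum.lessThan_Suc)
    consider "i = 0" | "i \<in> {1, 2}" | l where "i = l + 3" "l < Suc s"
    proof -
      have "i = 0 \<or> i \<in> {1, 2} \<or> i = (i - 3) + 3 \<and> i - 3 < Suc s"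
        using less s by auto
      then show thesis using that by blast
    qed
    then show ?thesis
    proof cases
      case 1
      then show ?thesis
        unfolding split using c_degree by (simp add: w_def s algebra_simps del: sum.lessThan_Suc)
    next
      case 2
      then show ?thesis
        unfolding split by (auto simp: w_def s algebra_simps simp del: sum.lessThan_Suc)
    next
      case 3
      have "(\<Sum>k<Suc s. w i (k + 3)) = (\<Sum>k<Suc s. c - (if k = l then c else 0))"
        by (rule sum.cong) (auto simp: 3 w_def)
      also have "\<dots> = s * c"
        using 3(2) by (simp add: sum_subtractf algebra_simps del: sum.lessThan_Suc)
      finally show ?thesis
        unfolding split using c_degree by (simp add: 3(1) w_def s algebra_simps)
    qed
  qed
  \<comment> \<open>Row \<open>i\<close> of \<open>P\<close> has ones in columns 0 and
    \<open>i\<close>, and for \<open>i = 2\<close> also in column 1. The guard on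
    \<open>i = 0\<close> avoids counting column 0 twice.\<close>
  have PD: "(P * D) $$ (i, j) = D $$ (0, j) + (if i = 0 then 0 else D $$ (i, j))
      + (if i = 2 then D $$ (1, j) else 0)" if ij: "i < t + 2" "j < t + 2" for i j
  proof -
    have "(P * D) $$ (i, j) = (\<Sum>k = 0..<t + 2. P $$ (i, k) * D $$ (k, j))"
      using ij by (simp add: P_def D_def scalar_prod_def)
    also have "\<dots> = (\<Sum>k = 0..<t + 2. (if k = 0 then D $$ (k, j) else 0)
        + (if k = i then if i = 0 then 0 else D $$ (k, j) else 0)
        + (if k = 1 then if i = 2 then D $$ (k, j) else 0 else 0))"
      using ij(1) by (intro sum.cong) (auto simp: P_def)
    also have "\<dots> = D $$ (0, j) + (if i = 0 then 0 else D $$ (i, j))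
      + (if i = 2 then D $$ (1, j) else 0)"
      using ij t by (simp add: sum.distrib del: sum.op_ivl_Suc)
    finally show ?thesis .
  qed
  show ?thesis
  proof (rule lambda2_triangularized[where P = P and D = D and n = "t + 2"])
    have "inj_on v {..<t + 2}" by (simp add: inj_on_def v_eq_iff)
    moreover have "v ` {..<t + 2} = verts (H_graph d t)"
    \<comment> \<open>Surjectivity by counting: \<open>v\<close> is injective on
      \<open>t + 2\<close> indices and the graph has \<open>t + 2\<close> vertices.\<close>
    proof (rule card_subset_eq)
      show "finite (verts (H_graph d t))" by (simp add: H_graph_def C_graph_def)
      show "card (v ` {..<t + 2}) = card (verts (H_graph d t))"
        using H_graph_regular(2)[OF assms] calculation by (simp add: card_image)
      show "v ` {..<t + 2} \<subseteq> verts (H_graph d t)"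
      proof (rule image_subsetI)
        fix i assume "i \<in> {..<t + 2}"
        then show "v i \<in> verts (H_graph d t)"
          using v_new[of i] v_old[of i]
          by (cases "i \<in> {1, 2}") (auto simp: H_graph_def C_graph_def)
      qed
    qed
    ultimately show "enumeration (H_graph d t) vs"
      by (simp add: enumeration_def vs_def distinct_map lessThan_atLeast0 del: upt_Suc)
    show "adj_mat (H_graph d t) vs * P = P * D"
      unfolding adj
    proof (rule eq_matI)
      fix i j assume "i < dim_row (P * D)" "j < dim_col (P * D)"
      then have ij: "i < t + 2" "j < t + 2" by (auto simp: P_def D_def)
      show "(mat (t + 2) (t + 2) (\<lambda>(i, j). w i j) * P) $$ (i, j) = (P * D) $$ (i, j)"
      \<comment> \<open>Multiplying by the all-ones column gives row sums. Every other column of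
        \<open>P\<close> is a unit vector, except that column 1 has a second one at index 2, for
        \<open>x + y\<close>.\<close>
      proof (cases "j = 0")
        case True
        have "(mat (t + 2) (t + 2) (\<lambda>(i, j). w i j) * P) $$ (i, j) = (\<Sum>k = 0..<t + 2. w i k)"
          using ij True by (simp add: P_def scalar_prod_def)
        also have "\<dots> = t * m" using row_sum ij by simp
        also have "\<dots> = (P * D) $$ (i, j)"
          using ij True by (simp add: PD) (simp add: D_def)
        finally show ?thesis .
      next
        case False
        have "(mat (t + 2) (t + 2) (\<lambda>(i, j). w i j) * P) $$ (i, j) =
            (\<Sum>k = 0..<t + 2. w i k * P $$ (k, j))"
          using ij by (simp add: P_def scalar_prod_def)
        also have "\<dots> = (\<Sum>k = 0..<t + 2. (if k = j then w i k else 0)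
            + (if k = 2 then if j = 1 then w i k else 0 else 0))"
          using ij(2) False by (intro sum.cong) (auto simp: P_def)
        also have "\<dots> = w i j + (if j = 1 then w i 2 else 0)"
          using ij t by (simp add: sum.distrib del: sum.op_ivl_Suc)
        also have "\<dots> = (P * D) $$ (i, j)"
          using ij False by (simp add: PD) (auto simp: D_def w_def)
        finally show ?thesis .
      qed
    qed (auto simp: P_def D_def)
    show "upper_triangular D"
      by (auto simp: D_def)
    \<comment> \<open>Since \<open>m\<close> and \<open>c\<close> are nonnegative,
      \<open>t * m\<close> and 0 are the two largest entries.\<close>
    show "mset (diag_mat D) =
        add_mset (t * m) (add_mset 0 (add_mset (- (2 * m)) (replicate_mset (t - 1) (- c))))"
    proof -
      have "diag_mat D = [t * m, - (2 * m), 0] @ replicate (t - 1) (- c)"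
        by (auto simp: list_eq_iff_nth_eq diag_mat_def D_def s nth_append nth_Cons split: nat.splits)
      then show ?thesis by simp
    qed
  qed (auto simp: vs_def P_def D_def m_def c_def split: if_splits)
qed

theorem lemma3p3:
  shows "(\<forall>d::nat. d \<ge> 3 \<and> 4 dvd d \<longrightarrow> lambda2 (H1_graph d) = 3 / 4 * real d) \<and>
         (\<forall>t d::nat. t \<ge> 2 \<and> d \<ge> 3 \<and> t dvd d \<and> t * (t - 1) dvd (t - 2) * d
            \<longrightarrow> lambda2 (H_graph d t) = 0)"
  using lambda2_H1_graph lambda2_H_graph by blast

end
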